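(* For any given boundary values $f(m)$ and $f(M)$, there is at most one viscosity solution $f$ on $[m,M]$ of the equation $$\min\{\delta f(r)-\mathcal A f(r)-G(r),\ f(r)-\mathcal M f(r)\}=0$$ with these boundary values, where $$\mathcal A f(r)=-c(r)f'(r)+\lambda\Big(\int_0^{r-m}f(r-s)\,dF(s)-f(r)\Big),\qquad \mathcal M f(r)=\sup_{0\le\zeta\le M-r}\big\{f(r+\zeta)-H(r+\zeta)+H(r)-k\big\}.$$
   Context: Standing assumptions: $m<M$ are real numbers; $c$ is positive, non-increasing and Lipschitz with constant $L$ on $[m,M]$; $\lambda>0$, $\delta>0$, $k>0$; $F$ is a probability distribution on $[0,\infty)$ whose support contains $[0,M-m]$; $G$ is a non-negative, continuous, increasing function on $[m,M]$; $H$ is continuous and increasing on $[m,M]$. Viscosity solutions. (i) A viscosity subsolution of the equation is an upper semi-continuous function $u$ on $[m,M]$ such that for each $\varphi\in C^1(m,M)$, $\min\{\delta\varphi(r)-\mathcal A\varphi(r)-G(r),\,u(r)-\mathcal M u(r)\}\le0$ at every $r\in(m,M)$ which is a maximizer of $u-\varphi$ with $u(r)=\varphi(r)$. (ii) A viscosity supersolution is a lower semi-continuous function $v$ on $[m,M]$ such that for each $\phi\in C^1(m,M)$, $\min\{\delta\phi(r)-\mathcal A\phi(r)-G(r),\,v(r)-\mathcal M v(r)\}\ge0$ at every $r\in(m,M)$ which is a minimizer of $v-\phi$ with $v(r)=\phi(r)$. (iii) A viscosity solution is a function that is both a viscosity subsolution and a viscosity supersolution. *)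

theory Defs
  imports "HOL-Probability.Probability"
begin

definition measure_support :: "'a::topological_space measure \<Rightarrow> 'a set" where
  "measure_support F = {x. \<forall>U. open U \<longrightarrow> x \<in> U \<longrightarrow> measure F U > 0}"

definition usc_on :: "'a::topological_space set \<Rightarrow> ('a \<Rightarrow> real) \<Rightarrow> bool" where
  "usc_on S f \<longleftrightarrow> (\<forall>x\<in>S. \<forall>a. f x < a \<longrightarrow> (\<forall>\<^sub>F y in at x within S. f y < a))"

definition lsc_on :: "'a::topological_space set \<Rightarrow> ('a \<Rightarrow> real) \<Rightarrow> bool" where
  "lsc_on S f \<longleftrightarrow> (\<forall>x\<in>S. \<forall>a. a < f x \<longrightarrow> (\<forall>\<^sub>F y in at x within S. a < f y))"

(* Functions on [m,M] are represented by total functions; only their values on {m..M} matter.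
   The integration range is the closed interval [0, r - m]: atoms of F at 0 and at r - m count. *)
definition integro_op ::
  "real \<Rightarrow> (real \<Rightarrow> real) \<Rightarrow> real \<Rightarrow> real measure \<Rightarrow> (real \<Rightarrow> real) \<Rightarrow> real \<Rightarrow> real" where
  "integro_op m c l F f r =
     - c r * deriv f r + l * ((LINT s:{0..r - m}|F. f (r - s)) - f r)"

(* Extended-real valued: a lower semi-continuous function on [m,M] need not be bounded above,
   and then the supremum is infinite. *)
definition intervention_op ::
  "real \<Rightarrow> (real \<Rightarrow> real) \<Rightarrow> real \<Rightarrow> (real \<Rightarrow> real) \<Rightarrow> real \<Rightarrow> ereal" where
  "intervention_op M H k f r =
     (SUP \<zeta>\<in>{0..M - r}. ereal (f (r + \<zeta>) - H (r + \<zeta>) + H r - k))"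

(* The test functions of class C^1 on (m,M) also carry values at m and M, since integro_op at r
   involves the value at m when F has an atom at r - m; accordingly extrema are taken over [m,M].
   A test function may be unbounded near m, hence the integrability condition: it says that
   integro_op is defined for the test function at r. *)
definition test_function_at ::
  "real \<Rightarrow> real \<Rightarrow> real measure \<Rightarrow> (real \<Rightarrow> real) \<Rightarrow> real \<Rightarrow> bool" where
  "test_function_at m M F \<phi> r \<longleftrightarrow>
     \<phi> C1_differentiable_on {m<..<M} \<and> set_integrable F {0..r - m} (\<lambda>s. \<phi> (r - s))"

definition viscosity_subsolution ::
  "real \<Rightarrow> real \<Rightarrow> (real \<Rightarrow> real) \<Rightarrow> real \<Rightarrow> real \<Rightarrow> real \<Rightarrow> real measure
     \<Rightarrow> (real \<Rightarrow> real) \<Rightarrow> (real \<Rightarrow> real) \<Rightarrow> (real \<Rightarrow> real) \<Rightarrow> bool" where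
  "viscosity_subsolution m M c l \<delta> k F G H u \<longleftrightarrow>
     usc_on {m..M} u \<and>
     (\<forall>\<phi>. \<forall>r\<in>{m<..<M}.
        test_function_at m M F \<phi> r \<longrightarrow>
        (\<forall>x\<in>{m..M}. u x - \<phi> x \<le> u r - \<phi> r) \<longrightarrow> u r = \<phi> r \<longrightarrow>
        min (ereal (\<delta> * \<phi> r - integro_op m c l F \<phi> r - G r))
            (ereal (u r) - intervention_op M H k u r) \<le> 0)"

definition viscosity_supersolution ::
  "real \<Rightarrow> real \<Rightarrow> (real \<Rightarrow> real) \<Rightarrow> real \<Rightarrow> real \<Rightarrow> real \<Rightarrow> real measure
     \<Rightarrow> (real \<Rightarrow> real) \<Rightarrow> (real \<Rightarrow> real) \<Rightarrow> (real \<Rightarrow> real) \<Rightarrow> bool" where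
  "viscosity_supersolution m M c l \<delta> k F G H v \<longleftrightarrow>
     lsc_on {m..M} v \<and>
     (\<forall>\<phi>. \<forall>r\<in>{m<..<M}.
        test_function_at m M F \<phi> r \<longrightarrow>
        (\<forall>x\<in>{m..M}. v x - \<phi> x \<ge> v r - \<phi> r) \<longrightarrow> v r = \<phi> r \<longrightarrow>
        min (ereal (\<delta> * \<phi> r - integro_op m c l F \<phi> r - G r))
            (ereal (v r) - intervention_op M H k v r) \<ge> 0)"

definition viscosity_solution ::
  "real \<Rightarrow> real \<Rightarrow> (real \<Rightarrow> real) \<Rightarrow> real \<Rightarrow> real \<Rightarrow> real \<Rightarrow> real measure
     \<Rightarrow> (real \<Rightarrow> real) \<Rightarrow> (real \<Rightarrow> real) \<Rightarrow> (real \<Rightarrow> real) \<Rightarrow> bool" where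
  "viscosity_solution m M c l \<delta> k F G H f \<longleftrightarrow>
     viscosity_subsolution m M c l \<delta> k F G H f \<and>
     viscosity_supersolution m M c l \<delta> k F G H f"

end

theory Submission
  imports Defs
begin

text \<open>Solutions are continuous. If \<open>u - v\<close> has a positive maximum, let \<open>r\<close> be the largest maximizer;
  it is interior, and \<open>k > 0\<close> together with \<open>v \<ge> M v\<close> excludes \<open>u \<le> M u\<close> at \<open>r\<close>, hence near \<open>r\<close>.
  So to the left of \<open>r\<close> the equations are first order: in the viscosity sense \<open>c u' \<le> A u\<close> and
  \<open>c v' \<ge> A v\<close>, where \<open>A\<close> collects the zeroth-order and integral terms. The left limits of \<open>A u\<close> and \<open>A v\<close> at
  \<open>r\<close> exist and differ by at most \<open>- \<delta> (u - v) r < 0\<close>, so \<open>u - v\<close> decreases strictly up to \<open>r\<close>,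
  a contradiction. Doubling of variables would require the integral term to be continuous, which fails
  when \<open>F\<close> has atoms; one-sided limits suffice in dimension one.\<close>

section \<open>Smoothness, bounds and semicontinuity on the real line\<close>

lemma C1_differentiable_onI_real:
  fixes f f' :: "real \<Rightarrow> real"
  assumes "\<And>x. x \<in> S \<Longrightarrow> (f has_real_derivative f' x) (at x)" "continuous_on S f'"
  shows "f C1_differentiable_on S"
  using assms unfolding C1_differentiable_on_def has_real_derivative_iff_has_vector_derivative by blast

lemma continuous_on_Icc_bound:
  fixes f :: "real \<Rightarrow> real"
  assumes "continuous_on {a..b} f"
  obtains B where "\<And>x. x \<in> {a..b} \<Longrightarrow> \<bar>f x\<bar> \<le> B" "0 < B"
proof -
  have "bounded (f ` {a..b})"
    using assms by (intro compact_imp_bounded compact_continuous_image) auto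
  then obtain B where "0 < B" "\<forall>y \<in> f ` {a..b}. norm y \<le> B"
    unfolding bounded_pos by blast
  then show thesis using that[of B] by simp
qed

lemma usc_lsc_imp_continuous_on:
  assumes "usc_on S f" "lsc_on S f"
  shows "continuous_on S f"
  using assms unfolding usc_on_def lsc_on_def continuous_on_def
  by (auto intro!: order_tendstoI)

section \<open>Touching from above in one dimension\<close>

text \<open>Multiplying by the Gaussian weight \<open>exp (- N * (x - x0)\<^sup>2)\<close> keeps the value and the first
  derivative at \<open>x0\<close> and removes the test function away from \<open>x0\<close>; there a Weierstrass
  approximation of \<open>u\<close> takes over.\<close>

lemma local_touching_imp_close_global:
  fixes u \<phi> \<phi>' :: "real \<Rightarrow> real"
  assumes u: "continuous_on {m..M} u" and x0: "x0 \<in> {m..M}"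
    and d: "\<And>x. (\<phi> has_real_derivative \<phi>' x) (at x)" "continuous_on UNIV \<phi>'"
    and "0 < \<rho>" and le: "\<And>x. x \<in> {m..M} \<Longrightarrow> \<bar>x - x0\<bar> < \<rho> \<Longrightarrow> u x \<le> \<phi> x"
    and eq: "u x0 = \<phi> x0" and "0 < \<eta>"
  obtains \<psi> where "\<psi> C1_differentiable_on UNIV" "(\<psi> has_real_derivative \<phi>' x0) (at x0)" "\<psi> x0 = u x0"
    "\<And>x. x \<in> {m..M} \<Longrightarrow> u x \<le> \<psi> x" "\<And>x. x \<in> {m..M} \<Longrightarrow> \<psi> x \<le> u x + \<eta>"
proof -
  have cphi: "continuous_on S \<phi>" for S
    using d(1) by (meson DERIV_isCont continuous_at_imp_continuous_on)
  have cdiff: "continuous_on {m..M} (\<lambda>x. \<phi> x - u x)"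
    using cphi u by (intro continuous_intros)
  obtain \<rho>1 where "\<rho>1 > 0"
    and r1: "\<And>x. x \<in> {m..M} \<Longrightarrow> dist x x0 < \<rho>1 \<Longrightarrow> dist (\<phi> x - u x) (\<phi> x0 - u x0) < \<eta>"
    using cdiff x0 \<open>0 < \<eta>\<close> unfolding continuous_on_iff by blast
  define \<sigma> where "\<sigma> = min \<rho> \<rho>1"
  have "\<sigma> > 0" using \<open>0 < \<rho>\<close> \<open>\<rho>1 > 0\<close> by (simp add: \<sigma>_def)
  have near: "0 \<le> \<phi> x - u x \<and> \<phi> x - u x \<le> \<eta>" if "x \<in> {m..M}" "\<bar>x - x0\<bar> < \<sigma>" for x
    using le[of x] r1[of x] that eq by (auto simp: \<sigma>_def dist_real_def)
  obtain B where "B > 0" and B: "\<And>x. x \<in> {m..M} \<Longrightarrow> \<bar>\<phi> x - u x\<bar> \<le> B"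
    using continuous_on_Icc_bound[OF cdiff] by blast
  obtain p where p: "real_polynomial_function p" "\<And>x. x \<in> {m..M} \<Longrightarrow> \<bar>u x - p x\<bar> < \<eta> / 8"
    using Stone_Weierstrass_real_polynomial_function[of "{m..M}" u "\<eta>/8"] u \<open>0 < \<eta>\<close> by auto
  then obtain p' where p': "real_polynomial_function p'" "\<And>x. (p has_real_derivative p' x) (at x)"
    using has_real_derivative_polynomial_function by blast
  have cp': "continuous_on UNIV p'"
    using p'(1) by (simp add: continuous_on_polymonial_function real_polynomial_function_eq)
  have cp: "continuous_on UNIV p"
    using p(1) by (simp add: continuous_on_polymonial_function real_polynomial_function_eq)
  \<comment> \<open>The approximation error is below \<open>\<eta> / 8\<close>; the shift by
    \<open>3 * \<eta> / 8\<close> puts \<open>w - u\<close> between \<open>\<eta> / 4\<close> and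
    \<open>\<eta> / 2\<close>, so \<open>w\<close> lies above \<open>u\<close> with room to
    spare.\<close>
  define w where "w x = p x + 3 * \<eta> / 8" for x
  have w: "\<eta>/4 \<le> w x - u x \<and> w x - u x \<le> \<eta>/2" if "x \<in> {m..M}" for x
    using p(2)[OF that] by (auto simp: w_def abs_if split: if_splits)
  \<comment> \<open>Where the weight is at most \<open>q\<close>, the \<open>\<phi>\<close> part of
    \<open>\<psi> - u\<close> has absolute value at most \<open>q * B\<close>, hence at most
    \<open>\<eta> / 8\<close>. As \<open>q\<close> is also at most \<open>1/2\<close>, the
    \<open>w\<close> part is at least \<open>\<eta> / 8\<close> and compensates it.\<close>
  define q where "q = min (1/2) (\<eta> / (8 * B))"
  have "q > 0" using \<open>B > 0\<close> \<open>0 < \<eta>\<close> by (simp add: q_def)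
  \<comment> \<open>Chosen so that \<open>exp (- N * \<sigma>\<^sup>2)\<close> is at most
    \<open>q\<close>.\<close>
  define N where "N = max 0 (- ln q / \<sigma>\<^sup>2)"
  have "N \<ge> 0" by (simp add: N_def)
  define E where "E x = exp (- N * (x - x0)\<^sup>2)" for x
  have E01: "0 \<le> E x" "E x \<le> 1" for x using \<open>N \<ge> 0\<close> by (auto simp: E_def)
  have Efar: "E x \<le> q" if "\<not> \<bar>x - x0\<bar> < \<sigma>" for x
  proof -
    have "\<sigma>\<^sup>2 \<le> (x - x0)\<^sup>2" using that \<open>\<sigma> > 0\<close> by (simp add: abs_le_square_iff[symmetric])
    then have "N * \<sigma>\<^sup>2 \<le> N * (x - x0)\<^sup>2" using \<open>N \<ge> 0\<close> by (rule mult_left_mono)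
    moreover have "- ln q / \<sigma>\<^sup>2 * \<sigma>\<^sup>2 \<le> N * \<sigma>\<^sup>2"
      by (intro mult_right_mono) (auto simp: N_def)
    then have "- ln q \<le> N * \<sigma>\<^sup>2" using \<open>\<sigma> > 0\<close> by simp
    ultimately have "- N * (x - x0)\<^sup>2 \<le> ln q" by simp
    then have "E x \<le> exp (ln q)" unfolding E_def by (simp only: exp_le_cancel_iff)
    then show ?thesis using \<open>q > 0\<close> by simp
  qed
  define \<psi> where "\<psi> x = E x * \<phi> x + (1 - E x) * w x" for x
  define E' where "E' x = E x * (- N * (2 * (x - x0)))" for x
  define \<psi>' where "\<psi>' x = E' x * \<phi> x + E x * \<phi>' x - E' x * w x + (1 - E x) * p' x" for x
  have dE: "(E has_real_derivative E' x) (at x)" for x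
    unfolding E_def E'_def by (auto intro!: derivative_eq_intros simp: E_def)
  have dw: "(w has_real_derivative p' x) (at x)" for x
    unfolding w_def by (auto intro!: derivative_eq_intros p'(2))
  have d\<psi>: "(\<psi> has_real_derivative \<psi>' x) (at x)" for x
    unfolding \<psi>_def \<psi>'_def
    by (auto intro!: derivative_eq_intros dE dw d(1) simp: algebra_simps)
  have "continuous_on UNIV E" "continuous_on UNIV E'" "continuous_on UNIV w"
    unfolding E'_def E_def w_def by (intro continuous_intros cp)+
  then have "continuous_on UNIV \<psi>'"
    unfolding \<psi>'_def using d(2) cphi cp' by (intro continuous_intros)
  then have 1: "\<psi> C1_differentiable_on UNIV"
    using d\<psi> by (intro C1_differentiable_onI_real)
  have "E x0 = 1" "E' x0 = 0" by (auto simp: E_def E'_def)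
  then have 2: "\<psi>' x0 = \<phi>' x0" "\<psi> x0 = u x0" by (auto simp: \<psi>'_def \<psi>_def eq)
  have 3: "u x \<le> \<psi> x \<and> \<psi> x \<le> u x + \<eta>" if x: "x \<in> {m..M}" for x
  proof -
    have split: "\<psi> x - u x = E x * (\<phi> x - u x) + (1 - E x) * (w x - u x)"
      by (simp add: \<psi>_def algebra_simps)
    have wb: "0 \<le> w x - u x" "w x - u x \<le> \<eta>" using w[OF x] \<open>0 < \<eta>\<close> by auto
    show ?thesis
    proof (cases "\<bar>x - x0\<bar> < \<sigma>")
      case True
      have "0 \<le> \<psi> x - u x" unfolding split using near[OF x True] wb E01[of x] by simp
      moreover have "\<psi> x - u x \<le> E x * \<eta> + (1 - E x) * \<eta>" unfolding split
        using near[OF x True] wb E01[of x] by (intro add_mono mult_left_mono) auto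
      ultimately show ?thesis by (simp add: algebra_simps)
    next
      case False
      have "\<bar>E x * (\<phi> x - u x)\<bar> \<le> q * B"
        unfolding abs_mult using Efar[OF False] E01[of x] B[OF x] by (intro mult_mono) auto
      also have "\<dots> \<le> \<eta> / (8 * B) * B"
        using \<open>B > 0\<close> by (intro mult_right_mono) (auto simp: q_def)
      finally have a: "\<bar>E x * (\<phi> x - u x)\<bar> \<le> \<eta> / 8" using \<open>B > 0\<close> by simp
      have "E x \<le> 1/2" using Efar[OF False] by (simp add: q_def)
      then have b: "1/2 * (\<eta>/4) \<le> (1 - E x) * (w x - u x)"
        using w[OF x] \<open>0 < \<eta>\<close> by (intro mult_mono) auto
      have c: "(1 - E x) * (w x - u x) \<le> 1 * (\<eta>/2)"
        using w[OF x] \<open>0 < \<eta>\<close> E01[of x] by (intro mult_mono) auto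
      show ?thesis using a b c split \<open>0 < \<eta>\<close> by (auto simp: abs_if split: if_splits)
    qed
  qed
  show thesis using that 1 2 3 d\<psi>[of x0] by metis
qed

text \<open>A function growing faster than \<open>K\<close> on average is touched from above at an interior point by a
  translate of \<open>K * x + \<epsilon> * exp (C * (x - b1))\<close>: for large \<open>C\<close> the exponential keeps the
  maximum of the difference away from \<open>b\<close>, and its derivative is positive.\<close>

lemma viscosity_derivative_bound_imp_growth_bound:
  fixes u :: "real \<Rightarrow> real"
  assumes "a < b" and u: "continuous_on {a..b} u"
    and visc: "\<And>x \<phi> \<phi>'. x \<in> {a<..<b} \<Longrightarrow> (\<And>y. (\<phi> has_real_derivative \<phi>' y) (at y)) \<Longrightarrow>
      continuous_on UNIV \<phi>' \<Longrightarrow> u x = \<phi> x \<Longrightarrow> (\<And>y. y \<in> {a..b} \<Longrightarrow> u y \<le> \<phi> y) \<Longrightarrow> \<phi>' x \<le> K"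
  shows "u b - u a \<le> K * (b - a)"
proof (rule ccontr)
  \<comment> \<open>Subtracting \<open>K * x\<close> turns excess growth into
    \<open>g a < g b\<close>, with slope 0 as the bound to violate.\<close>
  define g where "g x = u x - K * x" for x
  assume "\<not> ?thesis"
  then have gab: "g a < g b" by (simp add: g_def algebra_simps)
  have cg: "continuous_on {a..b} g" unfolding g_def using u by (intro continuous_intros)
  obtain e where "e > 0" and e: "\<And>x. x \<in> {a..b} \<Longrightarrow> dist x b < e \<Longrightarrow> dist (g x) (g b) < g b - g a"
  proof -
    have "b \<in> {a..b}" "0 < g b - g a" using gab \<open>a < b\<close> by auto
    then show ?thesis using cg that unfolding continuous_on_iff by blast
  qed
  define b1 where "b1 = max ((a + b)/2) (b - e/2)"
  have b1: "a < b1" "b1 < b" using \<open>a < b\<close> \<open>e > 0\<close> by (auto simp: b1_def max_def field_simps)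
  have "dist b1 b < e" using b1 \<open>e > 0\<close> by (auto simp: b1_def dist_real_def max_def field_simps split: if_splits)
  then have gb1: "g a < g b1" using e[of b1] b1 by (auto simp: dist_real_def)
  \<comment> \<open>With half of the gain as coefficient, the penalized function \<open>h\<close>
    below still satisfies \<open>h b1 > g a\<close>, since the exponential is 1 at
    \<open>b1\<close>.\<close>
  define \<epsilon> where "\<epsilon> = (g b1 - g a) / 2"
  have "\<epsilon> > 0" using gb1 by (simp add: \<epsilon>_def)
  \<comment> \<open>By \<open>exp y > y\<close>, the penalty at \<open>b\<close> exceeds
    \<open>g b - g a\<close>, so \<open>h b < g a\<close>. As also \<open>h a < g a < h b1\<close>,
    the maximum of \<open>h\<close> is interior.\<close>
  define C where "C = (g b - g a) / \<epsilon> / (b - b1)"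
  have "C > 0" using \<open>\<epsilon> > 0\<close> gab b1 by (simp add: C_def)
  have Cb: "C * (b - b1) = (g b - g a) / \<epsilon>" using b1 by (simp add: C_def)
  define h where "h x = g x - \<epsilon> * exp (C * (x - b1))" for x
  have "continuous_on {a..b} h" unfolding h_def using cg by (intro continuous_intros)
  then obtain x where x: "x \<in> {a..b}" "\<And>y. y \<in> {a..b} \<Longrightarrow> h y \<le> h x"
    using continuous_attains_sup[of "{a..b}" h] \<open>a < b\<close> by fastforce
  have hb1: "h b1 > g a" using gb1 by (simp add: h_def \<epsilon>_def field_simps)
  have "h a < g a" using \<open>\<epsilon> > 0\<close> by (simp add: h_def)
  moreover have "h b < g a"
  proof -
    have "(g b - g a) / \<epsilon> < exp (C * (b - b1))"
      unfolding Cb[symmetric] using exp_ge_add_one_self[of "C * (b - b1)"] by linarith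
    then have "g b - g a < \<epsilon> * exp (C * (b - b1))" using \<open>\<epsilon> > 0\<close> by (simp add: field_simps)
    then show ?thesis by (simp add: h_def)
  qed
  ultimately have xab: "x \<in> {a<..<b}"
    using x(1) x(2)[of b1] hb1 b1 by (cases "x = a"; cases "x = b") auto
  define \<phi> where "\<phi> y = h x + K * y + \<epsilon> * exp (C * (y - b1))" for y
  define \<phi>' where "\<phi>' y = K + \<epsilon> * (exp (C * (y - b1)) * C)" for y
  have "\<phi>' x \<le> K"
  proof (rule visc[OF xab])
    show "(\<phi> has_real_derivative \<phi>' y) (at y)" for y
      unfolding \<phi>_def \<phi>'_def by (auto intro!: derivative_eq_intros)
    show "continuous_on UNIV \<phi>'" unfolding \<phi>'_def by (intro continuous_intros)
    show "u x = \<phi> x" by (simp add: \<phi>_def h_def g_def)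
    show "u y \<le> \<phi> y" if "y \<in> {a..b}" for y
      using x(2)[OF that] by (simp add: \<phi>_def h_def g_def)
  qed
  moreover have "\<phi>' x > K" using \<open>\<epsilon> > 0\<close> \<open>C > 0\<close> by (simp add: \<phi>'_def)
  ultimately show False by simp
qed

section \<open>Integrals of reflected functions against \<open>F\<close>\<close>

text \<open>The set \<open>A\<close> is kept general because the left limit of the integral runs
  over the half-open range \<open>{0..<r - m}\<close>, while the operator itself uses the closed
  one.\<close>

lemma continuous_on_reflected_set_integrable:
  fixes u :: "real \<Rightarrow> real"
  assumes "finite_measure F" "sets F = sets borel" "continuous_on {m..M} u" "t \<le> M"
    and [measurable]: "A \<in> sets borel" and "A \<subseteq> {0..t - m}"
  shows "set_integrable F A (\<lambda>s. u (t - s))"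
proof -
  interpret finite_measure F by fact
  note assms(2)[measurable_cong]
  have c: "continuous_on {0..t - m} (\<lambda>s. u (t - s))"
    by (intro continuous_on_compose2[OF assms(3)] continuous_intros) (use assms(4) in auto)
  then obtain B where B: "\<And>s. s \<in> {0..t - m} \<Longrightarrow> \<bar>u (t - s)\<bar> \<le> B" "B > 0"
    using continuous_on_Icc_bound by blast
  have [measurable]: "(\<lambda>s. indicator {0..t - m} s *\<^sub>R u (t - s)) \<in> borel_measurable F"
    unfolding measurable_cong_sets[OF assms(2) refl]
    by (rule borel_measurable_continuous_on_indicator[OF _ c]) simp
  have "set_integrable F {0..t - m} (\<lambda>s. u (t - s))"
    unfolding set_integrable_def
  proof (rule integrable_const_bound)
    show "AE s in F. norm (indicat_real {0..t - m} s *\<^sub>R u (t - s)) \<le> B"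
      using B by (auto simp: indicator_def)
  qed fact
  then show ?thesis
    by (rule set_integrable_subset) (use assms in auto)
qed

text \<open>The mass of \<open>A\<close> is at most 1, so a pointwise excess \<open>\<eta>\<close>
  costs at most \<open>\<eta>\<close>. This serves both for small approximation errors and for
  \<open>\<eta>\<close> the maximum of \<open>u - v\<close>.\<close>

lemma set_integral_le_plus_const:
  fixes f g :: "'a \<Rightarrow> real"
  assumes "prob_space F" "set_integrable F A f" "set_integrable F A g" "A \<in> sets F" "0 \<le> \<eta>"
    and "\<And>s. s \<in> A \<Longrightarrow> f s \<le> g s + \<eta>"
  shows "(LINT s:A|F. f s) \<le> (LINT s:A|F. g s) + \<eta>"
proof -
  interpret prob_space F by fact
  have i: "set_integrable F A (\<lambda>s. \<eta>)"
    using assms(4) unfolding set_integrable_def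
    by (intro integrable_scaleR_left integrable_real_indicator) (auto simp: emeasure_finite less_top[symmetric])
  have "(LINT s:A|F. f s) \<le> (LINT s:A|F. g s + \<eta>)"
    using assms i by (intro set_integral_mono set_integral_add) auto
  also have "\<dots> = (LINT s:A|F. g s) + measure F A * \<eta>"
    using set_integral_add[OF assms(3) i] assms(4) by (simp add: set_lebesgue_integral_def)
  also have "\<dots> \<le> (LINT s:A|F. g s) + \<eta>"
    using mult_right_mono[OF prob_le_1[of A] assms(5)] by simp
  finally show ?thesis .
qed

text \<open>An atom of \<open>F\<close> at \<open>r - m\<close> makes the integral jump at \<open>r\<close>, so only the left limit is available,
  and the atom is not part of it.\<close>

lemma reflected_integral_tendsto_at_left:
  fixes u :: "real \<Rightarrow> real"
  assumes "finite_measure F" and sF: "sets F = sets borel" and u: "continuous_on {m..M} u"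
    and r: "m < r" "r \<le> M"
  shows "((\<lambda>t. LINT s:{0..t - m}|F. u (t - s)) \<longlongrightarrow> (LINT s:{0..<r - m}|F. u (r - s))) (at_left r)"
proof (rule tendsto_at_left_sequentially[OF r(1)])
  interpret finite_measure F by fact
  fix S :: "nat \<Rightarrow> real"
  assume S: "\<And>n. S n < r" "\<And>n. m < S n" "S \<longlonglongrightarrow> r"
  obtain B where B: "\<And>s. s \<in> {m..M} \<Longrightarrow> \<bar>u s\<bar> \<le> B" "B > 0"
    using continuous_on_Icc_bound[OF u] by blast
  have lim: "(\<lambda>n. indicat_real {0..S n - m} s *\<^sub>R u (S n - s)) \<longlonglongrightarrow> indicat_real {0..<r - m} s *\<^sub>R u (r - s)" for s
  proof (cases "s \<in> {0..<r - m}")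
    case True
    then have "\<forall>\<^sub>F n in sequentially. s + m < S n"
      using S(3) by (intro order_tendstoD(1)) auto
    then have ev: "\<forall>\<^sub>F n in sequentially. indicat_real {0..S n - m} s *\<^sub>R u (S n - s) = u (S n - s) \<and> S n - s \<in> {m..M}"
    proof eventually_elim
      case (elim n)
      show ?case using elim True S(1)[of n] r by (auto simp: indicator_def)
    qed
    have "(\<lambda>n. S n - s) \<longlonglongrightarrow> r - s" by (intro tendsto_intros S)
    then have "(\<lambda>n. u (S n - s)) \<longlonglongrightarrow> u (r - s)"
      by (rule continuous_on_tendsto_compose[OF u]) (use True r ev in \<open>auto elim: eventually_mono\<close>)
    moreover have "indicat_real {0..<r - m} s *\<^sub>R u (r - s) = u (r - s)" using True by simp
    ultimately show ?thesis
      using ev by (auto elim!: Lim_transform_eventually eventually_mono)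
  next
    \<comment> \<open>From the left, \<open>S n - m < r - m\<close>, so a point \<open>s\<close>
      with \<open>r - m \<le> s\<close> never enters the range. This is where an atom at
      \<open>r - m\<close> drops out.\<close>
    case False
    have "indicat_real {0..S n - m} s = 0" for n
      using False S(1)[of n] by (auto simp: indicator_def)
    then show ?thesis using False by simp
  qed
  show "(\<lambda>n. LINT s:{0..S n - m}|F. u (S n - s)) \<longlonglongrightarrow> (LINT s:{0..<r - m}|F. u (r - s))"
    unfolding set_lebesgue_integral_def
  proof (rule integral_dominated_convergence[where w="\<lambda>_. B"])
    have "set_integrable F {0..<r - m} (\<lambda>s. u (r - s))"
      by (rule continuous_on_reflected_set_integrable[OF _ sF u]) (use r in \<open>auto simp: finite_measure_axioms\<close>)
    then show "(\<lambda>s. indicat_real {0..<r - m} s *\<^sub>R u (r - s)) \<in> borel_measurable F"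
      unfolding set_integrable_def by blast
    fix n
    have "set_integrable F {0..S n - m} (\<lambda>s. u (S n - s))"
      by (rule continuous_on_reflected_set_integrable[OF _ sF u])
         (use r S(1)[of n] in \<open>auto simp: finite_measure_axioms\<close>)
    then show "(\<lambda>s. indicat_real {0..S n - m} s *\<^sub>R u (S n - s)) \<in> borel_measurable F"
      unfolding set_integrable_def by blast
    show "AE s in F. norm (indicat_real {0..S n - m} s *\<^sub>R u (S n - s)) \<le> B"
      using B r S(1)[of n] S(2)[of n] by (auto simp: indicator_def)
  qed (use lim in auto)
qed

section \<open>The intervention operator on continuous functions\<close>

text \<open>By compactness the supremum is a maximum: it is finite, and a strict upper bound on it
  can be checked at one target \<open>z = t + \<zeta>\<close>.\<close>

lemma intervention_op_attained:
  assumes "continuous_on {m..M} u" "continuous_on {m..M} H" "t \<in> {m..M}"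
  obtains z where "z \<in> {t..M}" "intervention_op M H k u t = ereal (u z - H z + H t - k)"
proof -
  have "continuous_on {t..M} (\<lambda>z. u z - H z + H t - k)"
    using assms by (intro continuous_intros) (auto elim: continuous_on_subset)
  then obtain z where z: "z \<in> {t..M}" "\<And>y. y \<in> {t..M} \<Longrightarrow> u y - H y + H t - k \<le> u z - H z + H t - k"
    using continuous_attains_sup[of "{t..M}" "\<lambda>z. u z - H z + H t - k"] assms(3) by fastforce
  have "intervention_op M H k u t = ereal (u z - H z + H t - k)"
    unfolding intervention_op_def
  proof (rule antisym)
    show "(SUP \<zeta>\<in>{0..M - t}. ereal (u (t + \<zeta>) - H (t + \<zeta>) + H t - k)) \<le> ereal (u z - H z + H t - k)"
    proof (rule SUP_least)
      fix \<zeta> assume "\<zeta> \<in> {0..M - t}"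
      then show "ereal (u (t + \<zeta>) - H (t + \<zeta>) + H t - k) \<le> ereal (u z - H z + H t - k)"
        using z(2)[of "t + \<zeta>"] by simp
    qed
    show "ereal (u z - H z + H t - k) \<le> (SUP \<zeta>\<in>{0..M - t}. ereal (u (t + \<zeta>) - H (t + \<zeta>) + H t - k))"
      using z(1) by (intro SUP_upper2[of "z - t"]) auto
  qed
  then show thesis using that z(1) by blast
qed

lemma intervention_op_ge:
  assumes "z \<in> {t..M}"
  shows "ereal (u z - H z + H t - k) \<le> intervention_op M H k u t"
  unfolding intervention_op_def using assms by (intro SUP_upper2[of "z - t"]) auto

section \<open>First-order inequalities at touching points\<close>

text \<open>The slope that the equation \<open>\<delta> u - A u - G = 0\<close> prescribes at
  \<open>t\<close>, obtained by solving it for the derivative.\<close>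

definition growth_rate ::
  "real \<Rightarrow> (real \<Rightarrow> real) \<Rightarrow> real \<Rightarrow> real \<Rightarrow> real measure \<Rightarrow> (real \<Rightarrow> real) \<Rightarrow> (real \<Rightarrow> real) \<Rightarrow> real \<Rightarrow> real" where
  "growth_rate m c l \<delta> F G u t =
     (l * ((LINT s:{0..t - m}|F. u (t - s)) - u t) + G t - \<delta> * u t) / c t"

lemma test_function_atI:
  assumes "finite_measure F" "sets F = sets borel" "\<psi> C1_differentiable_on UNIV"
  shows "test_function_at m M F \<psi> r"
  unfolding test_function_at_def
proof
  show "\<psi> C1_differentiable_on {m<..<M}" using assms(3) by (rule C1_differentiable_on_subset) simp
  have "continuous_on {m..r} \<psi>"
    using assms(3) by (meson C1_differentiable_imp_continuous_on continuous_on_subset subset_UNIV)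
  then show "set_integrable F {0..r - m} (\<lambda>s. \<psi> (r - s))"
    using assms by (intro continuous_on_reflected_set_integrable) auto
qed

text \<open>The definition demands global touching and integrates the test function; here touching
  is local and the integral is that of \<open>u\<close>. A global test function uniformly close to
  \<open>u\<close>, with the same slope at \<open>x\<close>, bridges the gap, and \<open>Mu\<close>
  forces the first entry of the minimum to be the nonpositive one.\<close>

lemma viscosity_subsolution_derivative_le:
  assumes F: "real_distribution F" and sub: "viscosity_subsolution m M c l \<delta> k F G H u"
    and u: "continuous_on {m..M} u" and x: "x \<in> {m<..<M}" and "0 < c x" "0 < l"
    and Mu: "intervention_op M H k u x < ereal (u x)"
    and d: "\<And>y. (\<phi> has_real_derivative \<phi>' y) (at y)" "continuous_on UNIV \<phi>'"
    and "0 < \<rho>" and le: "\<And>y. y \<in> {m..M} \<Longrightarrow> \<bar>y - x\<bar> < \<rho> \<Longrightarrow> u y \<le> \<phi> y" and eq: "u x = \<phi> x"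
  shows "\<phi>' x \<le> growth_rate m c l \<delta> F G u x"
proof -
  interpret real_distribution F by fact
  let ?J = "\<lambda>v. LINT s:{0..x - m}|F. v (x - s)"
  \<comment> \<open>The closeness is \<open>e / l\<close> because the integral carries the factor
    \<open>l\<close>; letting \<open>e\<close> tend to 0 removes the error.\<close>
  have "c x * \<phi>' x + \<delta> * u x - l * (?J u - u x) - G x \<le> 0 + e" if "e > 0" for e
  proof -
    have "0 < e / l" using that \<open>0 < l\<close> by simp
    obtain \<psi> where \<psi>: "\<psi> C1_differentiable_on UNIV" "(\<psi> has_real_derivative \<phi>' x) (at x)" "\<psi> x = u x"
      "\<And>y. y \<in> {m..M} \<Longrightarrow> u y \<le> \<psi> y" "\<And>y. y \<in> {m..M} \<Longrightarrow> \<psi> y \<le> u y + e / l"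
    proof (rule local_touching_imp_close_global[OF u _ d \<open>0 < \<rho>\<close> le eq])
      show "x \<in> {m..M}" using x by auto
    qed (use \<open>0 < e / l\<close> in auto)
    have tf: "test_function_at m M F \<psi> x"
      using \<psi>(1) by (intro test_function_atI finite_measure_axioms) auto
    have "min (ereal (\<delta> * \<psi> x - integro_op m c l F \<psi> x - G x)) (ereal (u x) - intervention_op M H k u x) \<le> 0"
    proof -
      have "\<forall>y\<in>{m..M}. u y - \<psi> y \<le> u x - \<psi> x" using \<psi>(3,4) by force
      then show ?thesis using sub tf x \<psi>(3) unfolding viscosity_subsolution_def by metis
    qed
    moreover have "0 < ereal (u x) - intervention_op M H k u x"
      using Mu by (cases "intervention_op M H k u x") auto
    ultimately have "\<delta> * \<psi> x - integro_op m c l F \<psi> x - G x \<le> 0"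
      by (auto simp: min_le_iff_disj)
    then have 1: "\<delta> * u x + c x * \<phi>' x - l * (?J \<psi> - u x) - G x \<le> 0"
      using DERIV_imp_deriv[OF \<psi>(2)] \<psi>(3) by (simp add: integro_op_def)
    have "?J \<psi> \<le> ?J u + e / l"
    proof (rule set_integral_le_plus_const)
      show "set_integrable F {0..x - m} (\<lambda>s. \<psi> (x - s))" using tf by (simp add: test_function_at_def)
      show "set_integrable F {0..x - m} (\<lambda>s. u (x - s))"
        using x by (intro continuous_on_reflected_set_integrable[OF finite_measure_axioms _ u]) auto
    qed (use \<psi>(5) x \<open>0 < e / l\<close> prob_space_axioms in auto)
    then have "l * ?J \<psi> \<le> l * (?J u + e / l)" using \<open>0 < l\<close> by (intro mult_left_mono) auto
    then show ?thesis using 1 \<open>0 < l\<close> by (simp add: algebra_simps)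
  qed
  then have "c x * \<phi>' x + \<delta> * u x - l * (?J u - u x) - G x \<le> 0"
    by (rule field_le_epsilon)
  then show ?thesis using \<open>0 < c x\<close> by (simp add: growth_rate_def field_simps)
qed

text \<open>A nonnegative minimum makes both entries nonnegative, so no case distinction arises. The
  second inequality is obtained only where \<open>v\<close> is touched from below by a smooth
  function.\<close>

lemma viscosity_supersolution_ge:
  assumes F: "real_distribution F" and super: "viscosity_supersolution m M c l \<delta> k F G H v"
    and v: "continuous_on {m..M} v" and x: "x \<in> {m<..<M}" and "0 < c x" "0 < l"
    and d: "\<And>y. (\<phi> has_real_derivative \<phi>' y) (at y)" "continuous_on UNIV \<phi>'"
    and "0 < \<rho>" and le: "\<And>y. y \<in> {m..M} \<Longrightarrow> \<bar>y - x\<bar> < \<rho> \<Longrightarrow> \<phi> y \<le> v y" and eq: "v x = \<phi> x"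
  shows "growth_rate m c l \<delta> F G v x \<le> \<phi>' x" "intervention_op M H k v x \<le> ereal (v x)"
proof -
  interpret real_distribution F by fact
  let ?J = "\<lambda>v. LINT s:{0..x - m}|F. v (x - s)"
  have main: "0 \<le> c x * \<phi>' x + \<delta> * v x - l * (?J v - v x) - G x + e \<and> intervention_op M H k v x \<le> ereal (v x)"
    if "e > 0" for e
  proof -
    have "0 < e / l" using that \<open>0 < l\<close> by simp
    \<comment> \<open>Touching from below is reduced to touching from above by passing to
      \<open>- v\<close> and \<open>- \<phi>\<close>.\<close>
    obtain \<xi> where \<xi>: "\<xi> C1_differentiable_on UNIV" "(\<xi> has_real_derivative - \<phi>' x) (at x)" "\<xi> x = - v x"
      "\<And>y. y \<in> {m..M} \<Longrightarrow> - v y \<le> \<xi> y" "\<And>y. y \<in> {m..M} \<Longrightarrow> \<xi> y \<le> - v y + e / l"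
    proof (rule local_touching_imp_close_global[where \<rho> = \<rho> and \<eta> = "e / l"])
      show "continuous_on {m..M} (\<lambda>y. - v y)" using v by (intro continuous_intros)
      show "((\<lambda>y. - \<phi> y) has_real_derivative - \<phi>' y) (at y)" for y
        using d(1)[of y] by (rule DERIV_minus)
      show "continuous_on UNIV (\<lambda>y. - \<phi>' y)" using d(2) by (intro continuous_intros)
      show "- v y \<le> - \<phi> y" if "y \<in> {m..M}" "\<bar>y - x\<bar> < \<rho>" for y using le[OF that] by simp
    qed (use x eq \<open>0 < \<rho>\<close> \<open>0 < e / l\<close> in auto)
    define \<psi> where "\<psi> y = - \<xi> y" for y
    have "(\<lambda>y. (-1) *\<^sub>R \<xi> y) C1_differentiable_on UNIV"
      by (intro C1_differentiable_on_scaleR C1_differentiable_on_const \<xi>)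
    then have C1: "\<psi> C1_differentiable_on UNIV" by (simp add: \<psi>_def[abs_def])
    have d\<psi>: "(\<psi> has_real_derivative \<phi>' x) (at x)"
      unfolding \<psi>_def using DERIV_minus[OF \<xi>(2)] by simp
    have tf: "test_function_at m M F \<psi> x"
      using C1 by (intro test_function_atI finite_measure_axioms) auto
    have "v x = \<psi> x" using \<xi>(3) by (simp add: \<psi>_def)
    moreover have "\<forall>y\<in>{m..M}. v y - \<psi> y \<ge> v x - \<psi> x" using \<xi>(3,4) by (force simp: \<psi>_def)
    ultimately have ge0: "min (ereal (\<delta> * \<psi> x - integro_op m c l F \<psi> x - G x)) (ereal (v x) - intervention_op M H k v x) \<ge> 0"
      using super tf x unfolding viscosity_supersolution_def by blast
    have Mv: "intervention_op M H k v x \<le> ereal (v x)"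
      using ge0 by (cases "intervention_op M H k v x") auto
    have "0 \<le> \<delta> * \<psi> x - integro_op m c l F \<psi> x - G x"
      using ge0 by auto
    then have 1: "0 \<le> \<delta> * v x + c x * \<phi>' x - l * (?J \<psi> - v x) - G x"
      using DERIV_imp_deriv[OF d\<psi>] \<xi>(3) by (simp add: integro_op_def \<psi>_def)
    have "?J v \<le> ?J \<psi> + e / l"
    proof (rule set_integral_le_plus_const)
      show "set_integrable F {0..x - m} (\<lambda>s. \<psi> (x - s))" using tf by (simp add: test_function_at_def)
      show "set_integrable F {0..x - m} (\<lambda>s. v (x - s))"
        using x by (intro continuous_on_reflected_set_integrable[OF finite_measure_axioms _ v]) auto
      show "v (x - s) \<le> \<psi> (x - s) + e / l" if "s \<in> {0..x - m}" for s
        using \<xi>(5)[of "x - s"] that x by (auto simp: \<psi>_def)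
    qed (use \<open>0 < e / l\<close> prob_space_axioms in auto)
    then have "l * ?J v \<le> l * (?J \<psi> + e / l)" using \<open>0 < l\<close> by (intro mult_left_mono) auto
    then show ?thesis using 1 Mv \<open>0 < l\<close> by (simp add: algebra_simps)
  qed
  then have "0 \<le> c x * \<phi>' x + \<delta> * v x - l * (?J v - v x) - G x"
    by (meson field_le_epsilon)
  then show "growth_rate m c l \<delta> F G v x \<le> \<phi>' x"
    using \<open>0 < c x\<close> by (simp add: growth_rate_def field_simps)
  show "intervention_op M H k v x \<le> ereal (v x)" using main[of 1] by simp
qed

text \<open>The limit may differ from \<open>growth_rate\<close> at \<open>r\<close> itself, since
  its integral omits the endpoint \<open>r - m\<close>.\<close>

lemma growth_rate_tendsto_at_left:
  assumes F: "real_distribution F" and u: "continuous_on {m..M} u" and r: "m < r" "r \<le> M"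
    and c: "continuous_on {m..M} c" "0 < c r" and G: "continuous_on {m..M} G"
  shows "((growth_rate m c l \<delta> F G u) \<longlongrightarrow>
    (l * ((LINT s:{0..<r - m}|F. u (r - s)) - u r) + G r - \<delta> * u r) / c r) (at_left r)"
proof -
  interpret real_distribution F by fact
  have lim: "(h \<longlongrightarrow> h r) (at_left r)" if h: "continuous_on {m..M} h" for h :: "real \<Rightarrow> real"
  proof -
    have "(h \<longlongrightarrow> h r) (at r within {m..r})"
      using continuous_on_subset[OF h, of "{m..r}"] r by (auto simp: continuous_on_def)
    then show ?thesis using r(1) by (simp add: at_within_Icc_at_left)
  qed
  have "((\<lambda>t. LINT s:{0..t - m}|F. u (t - s)) \<longlongrightarrow> (LINT s:{0..<r - m}|F. u (r - s))) (at_left r)"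
    by (rule reflected_integral_tendsto_at_left[OF finite_measure_axioms _ u r]) simp
  then show ?thesis unfolding growth_rate_def[abs_def]
    using c(2) by (intro tendsto_intros lim u c(1) G) auto
qed

section \<open>The intervention inequality at a point and in its neighbourhood\<close>

text \<open>Touching points from below are dense: minimize \<open>v y + N * (y - r)\<^sup>2\<close> with \<open>N\<close> large.\<close>

lemma viscosity_supersolution_ge_intervention:
  assumes F: "real_distribution F" and super: "viscosity_supersolution m M c l \<delta> k F G H v"
    and v: "continuous_on {m..M} v" and H: "continuous_on {m..M} H" and r: "r \<in> {m<..<M}"
    and c: "\<And>x. x \<in> {m..M} \<Longrightarrow> 0 < c x" and "0 < l" "0 < k" and z: "z \<in> {r..M}"
  shows "v z - H z + H r - k \<le> v r"
proof (cases "z = r")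
  case True
  then show ?thesis using \<open>0 < k\<close> by simp
next
  case False
  then have "r < z" using z by auto
  show ?thesis
  proof (rule ccontr)
    define h where "h x = v z - H z + H x - k - v x" for x
    assume "\<not> ?thesis"
    then have "h r > 0" by (simp add: h_def)
    have "continuous_on {m..M} h" unfolding h_def using v H by (intro continuous_intros)
    moreover have rM: "r \<in> {m..M}" using r by auto
    ultimately obtain e where "e > 0" and e: "\<And>x. x \<in> {m..M} \<Longrightarrow> dist x r < e \<Longrightarrow> dist (h x) (h r) < h r"
      using \<open>h r > 0\<close> unfolding continuous_on_iff by blast
    \<comment> \<open>Within \<open>\<sigma>\<close> of \<open>r\<close>, a point is interior, has
      \<open>z\<close> as an admissible target, and keeps \<open>h\<close> positive.\<close>
    define \<sigma> where "\<sigma> = Min {e, z - r, r - m, M - r}"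
    have \<sigma>: "0 < \<sigma>" "\<sigma> \<le> e" "\<sigma> \<le> z - r" "\<sigma> \<le> r - m" "\<sigma> \<le> M - r"
      using \<open>e > 0\<close> \<open>r < z\<close> r by (auto simp: \<sigma>_def)
    obtain B where B: "\<And>x. x \<in> {m..M} \<Longrightarrow> \<bar>v x\<bar> \<le> B" "B > 0"
      using continuous_on_Icc_bound[OF v] by blast
    \<comment> \<open>At distance at least \<open>\<sigma>\<close> the penalty is at least
      \<open>3 * B\<close>, more than the oscillation \<open>2 * B\<close> of \<open>v\<close>; so
      the minimizer is within \<open>\<sigma>\<close> of \<open>r\<close>.\<close>
    define N where "N = 3 * B / \<sigma>\<^sup>2"
    have "N > 0" using \<sigma>(1) B(2) by (simp add: N_def)
    have "continuous_on {m..M} (\<lambda>y. v y + N * (y - r)\<^sup>2)" using v by (intro continuous_intros)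
    then obtain x where x: "x \<in> {m..M}" "\<And>y. y \<in> {m..M} \<Longrightarrow> v x + N * (x - r)\<^sup>2 \<le> v y + N * (y - r)\<^sup>2"
      using continuous_attains_inf[of "{m..M}" "\<lambda>y. v y + N * (y - r)\<^sup>2"] rM by fastforce
    have xr: "\<bar>x - r\<bar> < \<sigma>"
    proof (rule ccontr)
      assume "\<not> ?thesis"
      then have "\<sigma>\<^sup>2 \<le> (x - r)\<^sup>2" using \<sigma>(1) by (simp add: abs_le_square_iff[symmetric])
      then have "N * \<sigma>\<^sup>2 \<le> N * (x - r)\<^sup>2" using \<open>N > 0\<close> by (intro mult_left_mono) auto
      moreover have "N * \<sigma>\<^sup>2 = 3 * B" using \<sigma>(1) by (simp add: N_def)
      ultimately show False using x(2)[OF rM] B(1)[OF rM] B(1)[OF x(1)] B(2) by simp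
    qed
    define \<phi> where "\<phi> y = v x + N * (x - r)\<^sup>2 - N * (y - r)\<^sup>2" for y
    define \<phi>' where "\<phi>' y = - (N * (2 * (y - r)))" for y
    have "intervention_op M H k v x \<le> ereal (v x)"
    proof (rule viscosity_supersolution_ge(2)[OF F super v _ _ \<open>0 < l\<close>])
      show "(\<phi> has_real_derivative \<phi>' y) (at y)" for y
        unfolding \<phi>_def \<phi>'_def by (auto intro!: derivative_eq_intros)
      show "continuous_on UNIV \<phi>'" unfolding \<phi>'_def by (intro continuous_intros)
      show "x \<in> {m<..<M}" using xr \<sigma> by auto
      show "\<phi> y \<le> v y" if "y \<in> {m..M}" for y using x(2)[OF that] by (simp add: \<phi>_def)
      show "(0::real) < 1" by simp
    qed (use c x(1) in \<open>auto simp: \<phi>_def\<close>)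
    moreover have "ereal (v z - H z + H x - k) \<le> intervention_op M H k v x"
      using xr \<sigma>(3) z by (intro intervention_op_ge) auto
    ultimately have "ereal (v z - H z + H x - k) \<le> ereal (v x)" by (rule order_trans[rotated])
    then have "h x \<le> 0" by (simp add: h_def)
    moreover have "dist (h x) (h r) < h r" using e[OF x(1)] xr \<sigma>(2) by (simp add: dist_real_def)
    ultimately show False by (simp add: dist_real_def)
  qed
qed

text \<open>The inequality \<open>u > M u\<close> persists on a neighbourhood, since the set where it fails is the
  projection of a compact set.\<close>

lemma intervention_op_less_nbhd:
  assumes u: "continuous_on {m..M} u" and H: "continuous_on {m..M} H" and r: "r \<in> {m..M}"
    and less: "\<And>z. z \<in> {r..M} \<Longrightarrow> u z - H z + H r - k < u r"
  obtains e where "e > 0" "\<And>t. t \<in> {m..M} \<Longrightarrow> \<bar>t - r\<bar> < e \<Longrightarrow> intervention_op M H k u t < ereal (u t)"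
proof -
  \<comment> \<open>The net gain from intervening at \<open>fst p\<close> with target
    \<open>snd p\<close>; \<open>T\<close> collects the admissible pairs. The inequality fails
    exactly on the projection of the part of \<open>T\<close> where \<open>g\<close> is
    nonnegative.\<close>
  define g where "g p = u (snd p) - H (snd p) + H (fst p) - k - u (fst p)" for p :: "real \<times> real"
  define T where "T = {p \<in> {m..M} \<times> {m..M}. fst p \<le> snd p}"
  have "closed {p :: real \<times> real. fst p \<le> snd p}"
    by (intro closed_Collect_le continuous_intros)
  moreover have "T = ({m..M} \<times> {m..M}) \<inter> {p. fst p \<le> snd p}" by (auto simp: T_def)
  ultimately have "compact T"
    by (simp add: compact_Int_closed compact_Times)
  have [continuous_intros]: "continuous_on T (\<lambda>p. h (fst p))" "continuous_on T (\<lambda>p. h (snd p))"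
    if "continuous_on {m..M} h" for h :: "real \<Rightarrow> real"
    by (rule continuous_on_compose2[OF that]; force intro: continuous_intros simp: T_def)+
  have "continuous_on T g" unfolding g_def using u H by (intro continuous_intros)
  then have "closed (T \<inter> g -` {0..})"
    using \<open>compact T\<close> by (intro continuous_closed_preimage compact_imp_closed closed_atLeast)
  then have "compact (T \<inter> g -` {0..})"
    using \<open>compact T\<close> by (metis compact_Int_closed inf.left_idem)
  then have "compact (fst ` (T \<inter> g -` {0..}))"
    by (intro compact_continuous_image continuous_intros)
  then have "open (- fst ` (T \<inter> g -` {0..}))" by (simp add: compact_imp_closed open_Compl)
  moreover have "r \<in> - fst ` (T \<inter> g -` {0..})"
    using less by (force simp: T_def g_def)
  ultimately obtain e where "e > 0" and e: "ball r e \<subseteq> - fst ` (T \<inter> g -` {0..})"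
    by (meson open_contains_ball)
  have "intervention_op M H k u t < ereal (u t)" if t: "t \<in> {m..M}" "\<bar>t - r\<bar> < e" for t
  proof -
    obtain z where z: "z \<in> {t..M}" "intervention_op M H k u t = ereal (u z - H z + H t - k)"
      using intervention_op_attained[OF u H t(1)] by blast
    have "t \<notin> fst ` (T \<inter> g -` {0..})"
      using e t by (auto simp: dist_real_def abs_minus_commute subset_iff)
    moreover have "(t, z) \<in> T" using z(1) t(1) by (auto simp: T_def)
    ultimately have "\<not> 0 \<le> g (t, z)" by force
    then show ?thesis using z(2) by (simp add: g_def)
  qed
  then show thesis using that \<open>e > 0\<close> by blast
qed

section \<open>Comparison and uniqueness\<close>

lemma viscosity_comparison:
  fixes m M l \<delta> k :: real and c G H u v :: "real \<Rightarrow> real"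
  assumes F: "real_distribution F"
    and c: "\<And>x. x \<in> {m..M} \<Longrightarrow> 0 < c x" "continuous_on {m..M} c"
    and G: "continuous_on {m..M} G" and H: "continuous_on {m..M} H"
    and pos: "0 < l" "0 < \<delta>" "0 < k"
    and u: "continuous_on {m..M} u" and v: "continuous_on {m..M} v"
    and sub: "viscosity_subsolution m M c l \<delta> k F G H u"
    and super: "viscosity_supersolution m M c l \<delta> k F G H v"
    and bdry: "u m \<le> v m" "u M \<le> v M" and x: "x \<in> {m..M}"
  shows "u x \<le> v x"
proof (rule ccontr)
  interpret real_distribution F by fact
  assume "\<not> ?thesis"
  then have "0 < u x - v x" by simp
  define w where "w t = u t - v t" for t
  have cw: "continuous_on {m..M} w" unfolding w_def using u v by (intro continuous_intros)
  obtain x1 where x1: "x1 \<in> {m..M}" "\<And>t. t \<in> {m..M} \<Longrightarrow> w t \<le> w x1"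
    using continuous_attains_sup[OF _ _ cw] x by fastforce
  \<comment> \<open>The maximizers of \<open>w\<close> form a compact set, so there is a largest
    one.\<close>
  have "closed ({m..M} \<inter> w -` {w x1..})"
    using cw by (intro continuous_closed_preimage) auto
  moreover have "{m..M} \<inter> w -` {w x1..} = {m..M} \<inter> ({m..M} \<inter> w -` {w x1..})" by auto
  ultimately have "compact ({m..M} \<inter> w -` {w x1..})"
    by (metis compact_Icc compact_Int_closed)
  moreover have "{m..M} \<inter> w -` {w x1..} \<noteq> {}" using x1(1) by auto
  ultimately obtain r where "r \<in> {m..M} \<inter> w -` {w x1..}" "\<forall>t \<in> {m..M} \<inter> w -` {w x1..}. t \<le> r"
    using compact_attains_sup by metis
  then have r0: "r \<in> {m..M}" "w x1 \<le> w r"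
    and r1: "\<And>t. t \<in> {m..M} \<Longrightarrow> w x1 \<le> w t \<Longrightarrow> t \<le> r"
    by auto
  have max: "w t \<le> w r" if "t \<in> {m..M}" for t using x1(2)[OF that] r0(2) by simp
  have "0 < w r" using max[OF x] \<open>0 < u x - v x\<close> by (simp add: w_def)
  then have r: "r \<in> {m<..<M}"
    using r0(1) bdry by (cases "r = m"; cases "r = M") (auto simp: w_def)
  \<comment> \<open>If intervening to \<open>z\<close> were worthwhile for \<open>u\<close>,
    subtracting the inequality for \<open>v\<close> would give \<open>w r \<le> w z\<close>. As
    \<open>k > 0\<close> excludes \<open>z = r\<close>, this \<open>z\<close> would be a maximizer
    to the right of \<open>r\<close>.\<close>
  have "u z - H z + H r - k < u r" if z: "z \<in> {r..M}" for z
  proof (rule ccontr)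
    assume "\<not> ?thesis"
    then have "w r \<le> w z" "z \<noteq> r"
      using viscosity_supersolution_ge_intervention[OF F super v H r c(1) pos(1,3) z] pos(3)
      by (auto simp: w_def)
    then show False using r1[of z] r0 z by auto
  qed
  then obtain e where "e > 0"
    and e: "\<And>t. t \<in> {m..M} \<Longrightarrow> \<bar>t - r\<bar> < e \<Longrightarrow> intervention_op M H k u t < ereal (u t)"
    using intervention_op_less_nbhd[OF u H r0(1), of k] by blast
  define \<alpha> where "\<alpha> = (l * ((LINT s:{0..<r - m}|F. u (r - s)) - u r) + G r - \<delta> * u r) / c r"
  define \<beta> where "\<beta> = (l * ((LINT s:{0..<r - m}|F. v (r - s)) - v r) + G r - \<delta> * v r) / c r"
  have "c r > 0" using c r0 by blast
  have "\<alpha> < \<beta>"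
  proof -
    \<comment> \<open>Maximality of \<open>w\<close> at \<open>r\<close> makes the nonlocal terms of
      \<open>u\<close> no larger than those of \<open>v\<close>; strictness then comes from
      \<open>\<delta> * w r > 0\<close>.\<close>
    have "(LINT s:{0..<r - m}|F. u (r - s)) \<le> (LINT s:{0..<r - m}|F. v (r - s)) + w r"
    proof (rule set_integral_le_plus_const[OF prob_space_axioms])
      show "set_integrable F {0..<r - m} (\<lambda>s. u (r - s))"
        using r by (intro continuous_on_reflected_set_integrable[OF finite_measure_axioms _ u]) auto
      show "set_integrable F {0..<r - m} (\<lambda>s. v (r - s))"
        using r by (intro continuous_on_reflected_set_integrable[OF finite_measure_axioms _ v]) auto
      show "u (r - s) \<le> v (r - s) + w r" if "s \<in> {0..<r - m}" for s
        using max[of "r - s"] that r by (auto simp: w_def)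
    qed (use \<open>0 < w r\<close> in auto)
    then have "l * ((LINT s:{0..<r - m}|F. u (r - s)) - u r) \<le> l * ((LINT s:{0..<r - m}|F. v (r - s)) - v r)"
      using pos(1) by (intro mult_left_mono) (auto simp: w_def)
    moreover have "\<delta> * v r < \<delta> * u r" using pos(2) \<open>0 < w r\<close> by (simp add: w_def)
    ultimately show ?thesis using \<open>c r > 0\<close> by (simp add: \<alpha>_def \<beta>_def divide_strict_right_mono)
  qed
  \<comment> \<open>Two separated levels survive the passage from the limits to a left neighbourhood
    of \<open>r\<close>.\<close>
  then obtain \<gamma> \<gamma>' where \<gamma>: "\<alpha> < \<gamma>" "\<gamma>' < \<beta>" "\<gamma> < \<gamma>'" by (meson dense)
  have rm: "m < r" "r \<le> M" using r by auto
  have "\<forall>\<^sub>F t in at_left r. growth_rate m c l \<delta> F G u t < \<gamma>"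
    using order_tendstoD(2)[OF growth_rate_tendsto_at_left[OF F u rm c(2) \<open>c r > 0\<close> G] \<gamma>(1)[unfolded \<alpha>_def]] .
  moreover have "\<forall>\<^sub>F t in at_left r. \<gamma>' < growth_rate m c l \<delta> F G v t"
    using order_tendstoD(1)[OF growth_rate_tendsto_at_left[OF F v rm c(2) \<open>c r > 0\<close> G] \<gamma>(2)[unfolded \<beta>_def]] .
  ultimately have "\<forall>\<^sub>F t in at_left r. growth_rate m c l \<delta> F G u t < \<gamma> \<and> \<gamma>' < growth_rate m c l \<delta> F G v t"
    by (rule eventually_conj)
  then obtain b where "b < r" and b: "\<And>t. b < t \<Longrightarrow> t < r \<Longrightarrow>
      growth_rate m c l \<delta> F G u t < \<gamma> \<and> \<gamma>' < growth_rate m c l \<delta> F G v t"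
    by (auto simp: eventually_at_left_field)
  obtain a0 where "max b (max m (r - e)) < a0" "a0 < r"
    using dense[of "max b (max m (r - e))" r] \<open>b < r\<close> rm \<open>e > 0\<close> by auto
  then have a0: "b < a0" "m < a0" "r - e < a0" "a0 < r" by auto
  define a where "a = (a0 + r) / 2"
  have a: "a0 < a" "a < r" using a0 by (auto simp: a_def)
  have sub_ar: "{a..r} \<subseteq> {m..M}" using a a0 rm by auto
  have "u r - u a \<le> \<gamma> * (r - a)"
  proof (rule viscosity_derivative_bound_imp_growth_bound[OF a(2)])
    fix t \<phi> \<phi>'
    assume t: "t \<in> {a<..<r}" and d: "\<And>y. (\<phi> has_real_derivative \<phi>' y) (at y)" "continuous_on UNIV \<phi>'"
      and eq: "u t = \<phi> t" and le: "\<And>y. y \<in> {a..r} \<Longrightarrow> u y \<le> \<phi> y"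
    have "\<phi>' t \<le> growth_rate m c l \<delta> F G u t"
    proof (rule viscosity_subsolution_derivative_le[OF F sub u _ _ pos(1) _ d])
      show "t \<in> {m<..<M}" "0 < c t" using t a a0 rm c(1)[of t] by auto
      show "intervention_op M H k u t < ereal (u t)" using t a a0 rm by (intro e) auto
      \<comment> \<open>Touching is known on \<open>{a..r}\<close> only; this radius stays inside
        it.\<close>
      show "0 < min (t - a) (r - t)" using t by auto
      show "u y \<le> \<phi> y" if "\<bar>y - t\<bar> < min (t - a) (r - t)" for y using le[of y] that unfolding min_less_iff_conj abs_less_iff by auto
    qed (rule eq)
    then show "\<phi>' t \<le> \<gamma>" using b[of t] t a a0 by auto
  qed (use continuous_on_subset[OF u sub_ar] in auto)
  \<comment> \<open>The lower bound \<open>\<gamma>'\<close> on the growth of \<open>v\<close> is an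
    upper bound for \<open>- v\<close>. Together with the bound for \<open>u\<close> it gives
    \<open>w r < w a\<close>, against maximality.\<close>
  moreover have "(- v r) - (- v a) \<le> (- \<gamma>') * (r - a)"
  proof (rule viscosity_derivative_bound_imp_growth_bound[OF a(2), of "\<lambda>y. - v y"])
    show "continuous_on {a..r} (\<lambda>y. - v y)"
      using continuous_on_subset[OF v sub_ar] by (intro continuous_intros)
    fix t \<phi> \<phi>'
    assume t: "t \<in> {a<..<r}" and d: "\<And>y. (\<phi> has_real_derivative \<phi>' y) (at y)" "continuous_on UNIV \<phi>'"
      and eq: "- v t = \<phi> t" and le: "\<And>y. y \<in> {a..r} \<Longrightarrow> - v y \<le> \<phi> y"
    have "growth_rate m c l \<delta> F G v t \<le> - \<phi>' t"
    proof (rule viscosity_supersolution_ge(1)[OF F super v _ _ pos(1)])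
      show "((\<lambda>y. - \<phi> y) has_real_derivative - \<phi>' y) (at y)" for y
        using d(1)[of y] by (rule DERIV_minus)
      show "continuous_on UNIV (\<lambda>y. - \<phi>' y)" using d(2) by (intro continuous_intros)
      show "t \<in> {m<..<M}" "0 < c t" using t a a0 rm c(1)[of t] by auto
      show "0 < min (t - a) (r - t)" using t by auto
      show "- \<phi> y \<le> v y" if "\<bar>y - t\<bar> < min (t - a) (r - t)" for y using le[of y] that unfolding min_less_iff_conj abs_less_iff by auto
    qed (use eq in auto)
    then show "\<phi>' t \<le> - \<gamma>'" using b[of t] t a a0 by auto
  qed
  ultimately have "w r - w a \<le> (\<gamma> - \<gamma>') * (r - a)" by (simp add: w_def algebra_simps)
  also have "\<dots> < 0" using \<gamma>(3) a(2) by (simp add: mult_neg_pos)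
  finally show False using max[of a] sub_ar a by auto
qed

theorem theorem4p6:
  fixes m M L l \<delta> k fm fM :: real
    and c G H f g :: "real \<Rightarrow> real"
    and F :: "real measure"
  assumes "m < M"
    and "\<forall>r\<in>{m..M}. 0 < c r"
    and "antimono_on {m..M} c"
    and "L-lipschitz_on {m..M} c"
    and "0 < l" and "0 < \<delta>" and "0 < k"
    and "real_distribution F"
    and "measure F {0..} = 1"
    and "{0..M - m} \<subseteq> measure_support F"
    and "\<forall>r\<in>{m..M}. 0 \<le> G r"
    and "continuous_on {m..M} G"
    and "mono_on {m..M} G"
    and "continuous_on {m..M} H"
    and "mono_on {m..M} H"
    and "viscosity_solution m M c l \<delta> k F G H f" and "f m = fm" and "f M = fM"
    and "viscosity_solution m M c l \<delta> k F G H g" and "g m = fm" and "g M = fM"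
  shows "\<forall>r\<in>{m..M}. f r = g r"
proof -
  have cont: "continuous_on {m..M} f" "continuous_on {m..M} g"
    using assms(16,19) unfolding viscosity_solution_def viscosity_subsolution_def viscosity_supersolution_def
    by (auto intro: usc_lsc_imp_continuous_on)
  have c: "continuous_on {m..M} c" using assms(4) by (rule lipschitz_on_continuous_on)
  have sol: "viscosity_subsolution m M c l \<delta> k F G H f" "viscosity_supersolution m M c l \<delta> k F G H f"
    "viscosity_subsolution m M c l \<delta> k F G H g" "viscosity_supersolution m M c l \<delta> k F G H g"
    using assms(16,19) by (auto simp: viscosity_solution_def)
  \<comment> \<open>Each solution is both a subsolution and a supersolution, so comparison applies
    in both directions.\<close>
  note compare = viscosity_comparison[OF assms(8) bspec[OF assms(2)] c assms(12,14,5,6,7)]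
  show ?thesis
  proof
    fix r assume r: "r \<in> {m..M}"
    have "f m = g m" "f M = g M" using assms(17,18,20,21) by simp_all
    then have "f r \<le> g r" "g r \<le> f r"
      using compare[OF _ cont sol(1,4) _ _ r] compare[OF _ cont(2,1) sol(3,2) _ _ r] by simp_all
    then show "f r = g r" by simp
  qed
qed

end
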